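(* Let $d \geq 2$ be an integer. For every $N > 0$ there exist $\lambda > 0$ and a nonzero function $f \in L^2(\mathbb{T}^d)$ with $-\Delta f = \lambda f$ such that $f$ vanishes to order at least $N$ at $0$, i.e. \[ \limsup_{\delta \to 0} \frac{\sup_{y \in B_\delta(0)} |f(y)|}{\delta^N} < \infty . \]
   Context: $\mathbb{T}^d = [-\pi,\pi)^d$ is the $d$-dimensional flat torus, i.e. opposite sides of the cube are identified, and $\Delta$ is the (non-positive, self-adjoint) Laplace operator on $\mathbb{T}^d$. Functions are complex-valued. Eigenfunctions of $\Delta$ are identified with their smooth representatives. $B_\delta(0)$ is the ball of radius $\delta$ around $0$ in $\mathbb{T}^d$. A function $f$ vanishes to order $N > 0$ at $x_0$ if $\limsup_{\delta \to 0} \delta^{-N} \sup_{y \in B_\delta(x_0)} |f(y)| < \infty$. *)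

theory Defs
  imports "HOL-Analysis.Analysis"
begin

text \<open>
  Functions on the flat torus are represented by functions on all of \<open>\<real>\<^sup>d\<close> that are
  \<open>2\<pi>\<close>-periodic in every coordinate; integrals are taken over the fundamental cube.
\<close>

definition torus_periodic :: "(real ^ 'd \<Rightarrow> 'a) \<Rightarrow> bool" where
  "torus_periodic f \<longleftrightarrow> (\<forall>i x. f (x + axis i (2 * pi)) = f x)"

definition torus_cube :: "(real ^ 'd) set" where
  "torus_cube = {x. \<forall>i. - pi \<le> x $ i \<and> x $ i < pi}"

definition torus_L2 :: "(real ^ 'd \<Rightarrow> complex) \<Rightarrow> bool" where
  "torus_L2 f \<longleftrightarrow> torus_periodic f \<and>
     f \<in> borel_measurable (lebesgue_on torus_cube) \<and>
     integrable (lebesgue_on torus_cube) (\<lambda>x. (cmod (f x))\<^sup>2)"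

definition torus_L2_norm :: "(real ^ 'd \<Rightarrow> complex) \<Rightarrow> real" where
  "torus_L2_norm f = sqrt (integral\<^sup>L (lebesgue_on torus_cube) (\<lambda>x. (cmod (f x))\<^sup>2))"

definition partial_deriv :: "'d \<Rightarrow> (real ^ 'd \<Rightarrow> complex) \<Rightarrow> real ^ 'd \<Rightarrow> complex" where
  "partial_deriv i f x = vector_derivative (\<lambda>t::real. f (x + t *\<^sub>R axis i 1)) (at 0)"

text \<open>\<open>C\<^sup>\<infinity>\<close>: all iterated partial derivatives exist and are continuous.\<close>

definition smooth_fun :: "(real ^ 'd \<Rightarrow> complex) \<Rightarrow> bool" where
  "smooth_fun f \<longleftrightarrow> (\<forall>is. continuous_on UNIV (foldr partial_deriv is f) \<and>
     (\<forall>i x. (\<lambda>t::real. foldr partial_deriv is f (x + t *\<^sub>R axis i 1)) differentiable (at 0)))"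

definition classical_laplacian :: "(real ^ 'd \<Rightarrow> complex) \<Rightarrow> real ^ 'd \<Rightarrow> complex" where
  "classical_laplacian f x = (\<Sum>i\<in>UNIV. partial_deriv i (partial_deriv i f) x)"

text \<open>
  Graph of the self-adjoint Laplace operator on \<open>L\<^sup>2\<close> of the torus: \<open>torus_laplacian u v\<close> means
  that \<open>u\<close> lies in its domain and \<open>\<Delta>u = v\<close> in \<open>L\<^sup>2\<close>. The classical Laplacian on smooth periodic
  functions is essentially self-adjoint, so the self-adjoint operator is its \<open>L\<^sup>2\<close>-closure.
\<close>

definition torus_laplacian ::
    "(real ^ 'd \<Rightarrow> complex) \<Rightarrow> (real ^ 'd \<Rightarrow> complex) \<Rightarrow> bool" where
  "torus_laplacian u v \<longleftrightarrow> torus_L2 u \<and> torus_L2 v \<and>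
     (\<exists>\<phi> :: nat \<Rightarrow> real ^ 'd \<Rightarrow> complex.
        (\<forall>n. torus_periodic (\<phi> n) \<and> smooth_fun (\<phi> n)) \<and>
        (\<lambda>n. torus_L2_norm (\<lambda>x. \<phi> n x - u x)) \<longlonglongrightarrow> 0 \<and>
        (\<lambda>n. torus_L2_norm (\<lambda>x. classical_laplacian (\<phi> n) x - v x)) \<longlonglongrightarrow> 0)"

text \<open>
  A ball of the torus is the image of the Euclidean ball of the same radius, so for periodic \<open>f\<close>
  the supremum over the Euclidean ball is the supremum over the torus ball. It is taken in the
  extended reals, hence equals \<open>\<infinity>\<close> if \<open>f\<close> is unbounded on the ball.
\<close>

definition vanishes_to_order :: "real \<Rightarrow> (real ^ 'd \<Rightarrow> complex) \<Rightarrow> real ^ 'd \<Rightarrow> bool" where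
  "vanishes_to_order N f x0 \<longleftrightarrow>
     Limsup (at_right 0)
       (\<lambda>\<delta>::real. (SUP y\<in>ball x0 \<delta>. ereal (cmod (f y))) / ereal (\<delta> powr N)) < \<infinity>"

end

theory Submission
  imports Defs "HOL-Computational_Algebra.Polynomial"
begin

text \<open>
  The Pythagorean parametrisation gives circles with arbitrarily many lattice points
  \<open>(a, b)\<close>. All plane waves \<open>exp (\<i>(a x\<^sub>p + b x\<^sub>q))\<close> with \<open>(a, b)\<close> on one circle belong to the
  same eigenvalue, and once there are more than \<open>M\<^sup>2\<close> of them, some nontrivial combination has all
  moments \<open>\<Sum> c a\<^sup>j b\<^sup>l\<close> with \<open>j, l < M\<close> equal to zero, so that its Taylor polynomial of degree
  below \<open>M\<close> at the origin vanishes.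
\<close>

section \<open>Linear algebra over a field\<close>

text \<open>Gaussian elimination by induction on the number of equations. A vanishing last equation
  is dropped; otherwise it is solved for one unknown \<open>r\<close>, which is substituted into the
  others. This costs one equation and one unknown, so the strict inequality survives.\<close>

lemma underdetermined_homogeneous_system:
  fixes A :: "nat \<Rightarrow> 'a \<Rightarrow> 'b::field"
  assumes "finite S" "n < card S"
  shows "\<exists>c. (\<exists>s\<in>S. c s \<noteq> 0) \<and> (\<forall>i<n. (\<Sum>s\<in>S. A i s * c s) = 0)"
  using assms
proof (induction n arbitrary: S A)
  case 0
  then have "S \<noteq> {}" by auto
  then show ?case by (intro exI[of _ "\<lambda>_. 1"]) auto
next
  case (Suc n)
  show ?case
  proof (cases "\<forall>s\<in>S. A n s = 0")
    case True
    obtain c where "\<exists>s\<in>S. c s \<noteq> 0" "\<forall>i<n. (\<Sum>s\<in>S. A i s * c s) = 0"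
      using Suc.IH[of S A] Suc.prems by auto
    then show ?thesis using True by (intro exI[of _ c]) (auto simp: less_Suc_eq)
  next
    case False
    then obtain r where r: "r \<in> S" "A n r \<noteq> 0" by blast
    let ?T = "S - {r}"
    have T: "finite ?T" "n < card ?T" using Suc.prems r by auto
    obtain c where c: "\<exists>s\<in>?T. c s \<noteq> 0"
      "\<And>i. i < n \<Longrightarrow> (\<Sum>s\<in>?T. (A i s - A n s / A n r * A i r) * c s) = 0"
      using Suc.IH[OF T, of "\<lambda>i s. A i s - A n s / A n r * A i r"] by blast
    \<comment> \<open>The value of the unknown \<open>r\<close> that the last equation forces once
      the others are given by \<open>c\<close>.\<close>
    define u where "u = - (\<Sum>s\<in>?T. A n s * c s) / A n r"
    have split: "(\<Sum>s\<in>S. A i s * (c(r := u)) s) = A i r * u + (\<Sum>s\<in>?T. A i s * c s)" for i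
      using Suc.prems r by (subst sum.remove[of S r]) (auto intro!: sum.cong)
    have "(\<Sum>s\<in>S. A i s * (c(r := u)) s) = 0" if "i < Suc n" for i
    proof (cases "i = n")
      case True
      then show ?thesis using r by (simp only: split) (simp add: u_def)
    next
      case False
      then have "0 = (\<Sum>s\<in>?T. (A i s - A n s / A n r * A i r) * c s)"
        using c(2)[of i] that by simp
      also have "\<dots> = (\<Sum>s\<in>?T. A i s * c s) - A i r / A n r * (\<Sum>s\<in>?T. A n s * c s)"
        by (simp add: algebra_simps sum_subtractf sum_distrib_left)
      finally show ?thesis by (simp only: split) (simp add: u_def)
    qed
    moreover have "\<exists>s\<in>S. (c(r := u)) s \<noteq> 0" using c(1) by auto
    ultimately show ?thesis by blast
  qed
qed

section \<open>Lattice points on a circle\<close>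

text \<open>The rational points ((t^2-1)/(t^2+1), 2t/(t^2+1)) of the unit circle, for t = 1, ..., n,
  are multiplied by the common denominator \<open>D\<close>. Distinct first coordinates are demanded
  because nontriviality is later tested on a single coordinate axis.\<close>

lemma circle_with_many_lattice_points:
  "\<exists>(L::nat) K :: (nat \<times> nat) set. L > 0 \<and> finite K \<and> card K = n \<and> inj_on fst K \<and>
     (\<forall>(a, b)\<in>K. a\<^sup>2 + b\<^sup>2 = L)"
proof -
  \<comment> \<open>\<open>P t\<close> is \<open>D\<close> divided by 1 + t^2, written as a product
    to avoid division.\<close>
  define P :: "nat \<Rightarrow> nat" where "P t = (\<Prod>s\<in>{1..n}-{t}. 1 + s\<^sup>2)" for t
  define D :: nat where "D = (\<Prod>s\<in>{1..n}. 1 + s\<^sup>2)"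
  have pos: "P t > 0" for t unfolding P_def by (intro prod_pos) simp
  have DP: "D = (1 + t\<^sup>2) * P t" if "t \<in> {1..n}" for t
    unfolding D_def P_def using that by (subst prod.remove[of _ t]) auto
  define k where "k t = ((t\<^sup>2 - 1) * P t, 2 * t * P t)" for t
  \<comment> \<open>The first coordinate is \<open>D - 2 * P t\<close>, so its injectivity reduces
    to that of \<open>P\<close>. The additive form avoids truncated subtraction.\<close>
  have fst_k: "fst (k t) + 2 * P t = D" if "t \<in> {1..n}" for t
  proof -
    have "t\<^sup>2 \<ge> 1" using that by simp
    then have "(t\<^sup>2 - 1) * P t + 2 * P t = (1 + t\<^sup>2) * P t"
      by (metis (no_types, opaque_lifting) add.commute add.left_commute
          le_add_diff_inverse2 distrib_right one_add_one)
    then show ?thesis using DP[OF that] by (simp add: k_def)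
  qed
  have inj: "inj_on (fst \<circ> k) {1..n}"
  proof (rule inj_onI)
    fix s t assume st: "s \<in> {1..n}" "t \<in> {1..n}" "(fst \<circ> k) s = (fst \<circ> k) t"
    then have "P s = P t" using fst_k[of s] fst_k[of t] by simp
    then have "(1 + s\<^sup>2) * P t = (1 + t\<^sup>2) * P t"
      using DP[OF st(1)] DP[OF st(2)] by metis
    then have "1 + s\<^sup>2 = 1 + t\<^sup>2" using pos[of t] by (subst (asm) mult_right_cancel) simp_all
    then show "s = t" by simp
  qed
  have norm: "(fst (k t))\<^sup>2 + (snd (k t))\<^sup>2 = D\<^sup>2" if t: "t \<in> {1..n}" for t
  proof -
    obtain m where m: "t\<^sup>2 = Suc m" using t by (cases "t\<^sup>2") auto
    have "(fst (k t))\<^sup>2 + (snd (k t))\<^sup>2 = (m\<^sup>2 + 4 * Suc m) * (P t)\<^sup>2"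
      unfolding k_def fst_conv snd_conv power_mult_distrib m by (simp add: distrib_right)
    also have "m\<^sup>2 + 4 * Suc m = (1 + t\<^sup>2)\<^sup>2"
      unfolding m by (simp add: power2_eq_square)
    also have "\<dots> * (P t)\<^sup>2 = ((1 + t\<^sup>2) * P t)\<^sup>2"
      by (rule power_mult_distrib[symmetric])
    finally show ?thesis using DP[OF t] by simp
  qed
  have "D > 0" unfolding D_def by (intro prod_pos) simp
  moreover have "card (k ` {1..n}) = n"
    using inj_on_imageI2[OF inj] by (simp add: card_image)
  moreover have "inj_on fst (k ` {1..n})" using inj by (rule inj_on_imageI)
  ultimately show ?thesis using norm
    by (intro exI[of _ "D\<^sup>2"] exI[of _ "k ` {1..n}"]) (auto simp: case_prod_beta)
qed

section \<open>Trigonometric sums and their derivatives\<close>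

text \<open>With the coefficients as a parameter, the family is closed under partial derivatives:
  \<open>K\<close> and \<open>\<kappa>\<close> stay fixed and only \<open>c\<close> changes.
  Smoothness thus reduces to continuity and one differentiation.\<close>

definition plane_waves :: "'k set \<Rightarrow> ('k \<Rightarrow> real ^ 'd) \<Rightarrow> ('k \<Rightarrow> complex) \<Rightarrow> real ^ 'd \<Rightarrow> complex" where
  "plane_waves K \<kappa> c x = (\<Sum>k\<in>K. c k * exp (\<i> * complex_of_real (\<kappa> k \<bullet> x)))"

lemma plane_waves_line_derivative:
  "((\<lambda>t. plane_waves K \<kappa> c (x + t *\<^sub>R axis i 1)) has_vector_derivative
      plane_waves K \<kappa> (\<lambda>k. \<i> * complex_of_real (\<kappa> k $ i) * c k) x) (at 0)"
  unfolding plane_waves_def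
proof (rule has_vector_derivative_sum)
  fix k
  \<comment> \<open>The exponent is affine in \<open>of_real t\<close>, so the real derivative is
    the restriction of a complex one.\<close>
  have "((\<lambda>t. c k * exp (\<i> * of_real (\<kappa> k \<bullet> x) + of_real t * (\<i> * of_real (\<kappa> k $ i))))
     has_vector_derivative \<i> * complex_of_real (\<kappa> k $ i) * c k * exp (\<i> * of_real (\<kappa> k \<bullet> x))) (at 0)"
    by (rule has_vector_derivative_real_field)
       (auto intro!: derivative_eq_intros)
  then show "((\<lambda>t. c k * exp (\<i> * complex_of_real (\<kappa> k \<bullet> (x + t *\<^sub>R axis i 1))))
     has_vector_derivative \<i> * complex_of_real (\<kappa> k $ i) * c k * exp (\<i> * of_real (\<kappa> k \<bullet> x))) (at 0)"
    by (simp add: inner_add_right inner_axis algebra_simps)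
qed

lemma partial_deriv_plane_waves:
  "partial_deriv i (plane_waves K \<kappa> c) =
     plane_waves K \<kappa> (\<lambda>k. \<i> * complex_of_real (\<kappa> k $ i) * c k)"
  unfolding partial_deriv_def
  by (rule ext, rule vector_derivative_at, rule plane_waves_line_derivative)

lemma continuous_on_plane_waves: "continuous_on A (plane_waves K \<kappa> c)"
  unfolding plane_waves_def by (intro continuous_intros)

lemma smooth_plane_waves: "smooth_fun (plane_waves K \<kappa> c)"
proof -
  have iter: "\<exists>c'. foldr partial_deriv js (plane_waves K \<kappa> c) = plane_waves K \<kappa> c'" for js
    by (induction js) (auto simp: partial_deriv_plane_waves)
  show ?thesis unfolding smooth_fun_def
  proof
    fix js
    obtain c' where "foldr partial_deriv js (plane_waves K \<kappa> c) = plane_waves K \<kappa> c'"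
      using iter by blast
    then show "continuous_on UNIV (foldr partial_deriv js (plane_waves K \<kappa> c)) \<and>
        (\<forall>i x. (\<lambda>t. foldr partial_deriv js (plane_waves K \<kappa> c) (x + t *\<^sub>R axis i 1))
          differentiable at 0)"
      by (simp add: continuous_on_plane_waves
          differentiableI_vector[OF plane_waves_line_derivative])
  qed
qed

lemma classical_laplacian_plane_waves:
  assumes "\<And>k. k \<in> K \<Longrightarrow> \<kappa> k \<bullet> \<kappa> k = lam"
  shows "classical_laplacian (plane_waves K \<kappa> c) x = - (of_real lam * plane_waves K \<kappa> c x)"
proof -
  have "classical_laplacian (plane_waves K \<kappa> c) x =
    (\<Sum>i\<in>UNIV. \<Sum>k\<in>K. - (of_real (\<kappa> k $ i * \<kappa> k $ i) * (c k * exp (\<i> * of_real (\<kappa> k \<bullet> x)))))"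
    unfolding classical_laplacian_def partial_deriv_plane_waves plane_waves_def
    by (intro sum.cong refl) (simp add: complex_eq_iff algebra_simps)
  also have "\<dots> = (\<Sum>k\<in>K. - (of_real (\<kappa> k \<bullet> \<kappa> k) * (c k * exp (\<i> * of_real (\<kappa> k \<bullet> x)))))"
    by (subst sum.swap) (simp add: inner_vec_def sum_negf sum_distrib_right)
  also have "\<dots> = - (of_real lam * plane_waves K \<kappa> c x)"
    by (simp add: assms plane_waves_def sum_negf sum_distrib_left)
  finally show ?thesis .
qed

lemma torus_periodic_plane_waves:
  assumes "\<And>k i. k \<in> K \<Longrightarrow> \<kappa> k $ i \<in> \<int>"
  shows "torus_periodic (plane_waves K \<kappa> c)"
  unfolding torus_periodic_def plane_waves_def
proof (intro allI sum.cong refl)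
  fix i x k assume "k \<in> K"
  then obtain m where m: "\<kappa> k $ i = of_int m" using assms Ints_cases by metis
  have "exp (\<i> * complex_of_real (\<kappa> k \<bullet> (x + axis i (2 * pi)))) =
      exp (\<i> * of_real (\<kappa> k \<bullet> x)) * exp (2 * of_int m * of_real pi * \<i>)"
    by (simp add: inner_add_right inner_axis m exp_add[symmetric] algebra_simps)
  then show "c k * exp (\<i> * complex_of_real (\<kappa> k \<bullet> (x + axis i (2 * pi)))) =
      c k * exp (\<i> * complex_of_real (\<kappa> k \<bullet> x))"
    using exp_integer_2pi[of "of_int m"] by simp
qed

section \<open>Square integrability and the Laplacian on the cube\<close>

text \<open>The half-open cube is neither open nor closed, but bounded convex sets are measurable
  with finite measure.\<close>

lemma lmeasurable_torus_cube: "(torus_cube :: (real ^ 'd) set) \<in> lmeasurable"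
proof (rule measurable_convex)
  show "convex (torus_cube :: (real ^ 'd) set)"
    unfolding torus_cube_def convex_alt
  proof (intro ballI allI impI, clarsimp)
    fix x y :: "real ^ 'd" and u :: real and i
    assume *: "\<forall>i. - pi \<le> x $ i \<and> x $ i < pi" "\<forall>i. - pi \<le> y $ i \<and> y $ i < pi" "0 \<le> u" "u \<le> 1"
    have "convex {-pi..<pi}" by simp
    then show "- pi \<le> (1 - u) * x $ i + u * y $ i \<and> (1 - u) * x $ i + u * y $ i < pi"
      using * unfolding convex_alt by auto
  qed
  have "(torus_cube :: (real ^ 'd) set) \<subseteq> cbox (\<chi> i. - pi) (\<chi> i. pi)"
    by (auto simp: torus_cube_def mem_box_cart less_imp_le)
  then show "bounded (torus_cube :: (real ^ 'd) set)"
    using bounded_subset bounded_cbox by blast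
qed

lemma torus_L2_continuous:
  assumes cont: "continuous_on UNIV f" and "torus_periodic f" and bound: "\<And>x. cmod (f x) \<le> B"
  shows "torus_L2 f"
  unfolding torus_L2_def
proof (intro conjI)
  have meas: "g \<in> borel_measurable (lebesgue_on torus_cube)" if "continuous_on UNIV g"
    for g :: "real ^ 'd \<Rightarrow> 'b::euclidean_space"
    using continuous_imp_measurable_on_sets_lebesgue[OF continuous_on_subset[OF that]]
      lmeasurable_torus_cube by (meson fmeasurableD subset_UNIV)
  show "f \<in> borel_measurable (lebesgue_on torus_cube)" using cont by (rule meas)
  interpret finite_measure "lebesgue_on (torus_cube :: (real ^ 'd) set)"
    using lmeasurable_torus_cube by (rule finite_measure_lebesgue_on)
  show "integrable (lebesgue_on torus_cube) (\<lambda>x. (cmod (f x))\<^sup>2)"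
  proof (rule integrable_const_bound[of _ "B\<^sup>2"])
    show "(\<lambda>x. (cmod (f x))\<^sup>2) \<in> borel_measurable (lebesgue_on torus_cube)"
      by (rule meas) (intro continuous_intros cont)
  qed (use bound in \<open>auto intro!: power_mono\<close>)
qed (fact assms)

lemma norm_plane_waves_le: "cmod (plane_waves K \<kappa> c x) \<le> (\<Sum>k\<in>K. cmod (c k))"
  unfolding plane_waves_def by (rule sum_norm_le) (simp add: norm_mult)

text \<open>The graph is a closure, so the constant sequence \<open>f\<close> serves as
  approximation, both distances being zero.\<close>

lemma torus_laplacian_classical:
  assumes "torus_L2 f" "smooth_fun f" "torus_L2 (\<lambda>x. classical_laplacian f x)"
  shows "torus_laplacian f (\<lambda>x. classical_laplacian f x)"
  unfolding torus_laplacian_def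
proof (intro conjI exI[of _ "\<lambda>_. f"])
  show "\<forall>n. torus_periodic f \<and> smooth_fun f" using assms by (simp add: torus_L2_def)
qed (simp_all add: assms torus_L2_norm_def)

text \<open>Inside the open cube, the set where a continuous \<open>f\<close> is nonzero is open.
  Being null, it is empty.\<close>

lemma AE_torus_cube_eq_0_imp:
  fixes f :: "real ^ 'd \<Rightarrow> complex"
  assumes cont: "continuous_on UNIV f" and ae: "AE x in lebesgue_on torus_cube. f x = 0"
    and x: "\<And>i. - pi < x $ i \<and> x $ i < pi"
  shows "f x = 0"
proof (rule ccontr)
  assume "f x \<noteq> 0"
  let ?U = "box (\<chi> i. - pi) (\<chi> i. pi) \<inter> f -` (- {0})"
  have cube: "torus_cube \<in> sets (lebesgue :: (real ^ 'd) measure)"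
    using lmeasurable_torus_cube by blast
  have "AE y in lebesgue. y \<in> torus_cube \<longrightarrow> f y = 0"
    using ae cube by (subst (asm) AE_restrict_space_iff) auto
  then have "AE y in lebesgue. y \<notin> ?U"
    by eventually_elim (auto simp: torus_cube_def mem_box_cart less_imp_le)
  moreover have op: "open ?U"
    by (intro open_Int open_box open_vimage[OF _ cont]) auto
  ultimately have "negligible ?U"
    by (simp add: negligible_iff_null_sets AE_iff_null_sets)
  moreover have "x \<in> ?U" using x \<open>f x \<noteq> 0\<close> by (auto simp: mem_box_cart)
  ultimately show False using open_not_negligible[OF op] by blast
qed

section \<open>Order of vanishing at the origin\<close>

text \<open>
  Every Taylor coefficient of \<open>plane_waves K \<kappa> c\<close> of order below \<open>M\<close> is one of the moments
  assumed to vanish, so only the Taylor remainder of the exponential is left.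
\<close>

lemma norm_plane_waves_le_power:
  assumes moments: "\<And>j x. j < M \<Longrightarrow> (\<Sum>k\<in>K. c k * of_real (\<kappa> k \<bullet> x) ^ j) = 0"
    and "M > 0"
  shows "cmod (plane_waves K \<kappa> c x) \<le> (\<Sum>k\<in>K. cmod (c k) * norm (\<kappa> k) ^ M) * norm x ^ M"
proof -
  obtain n where n: "M = Suc n" using \<open>M > 0\<close> gr0_conv_Suc by auto
  let ?z = "\<lambda>k. \<i> * complex_of_real (\<kappa> k \<bullet> x)"
  have "(\<Sum>k\<in>K. c k * (\<Sum>j\<le>n. ?z k ^ j / fact j)) =
      (\<Sum>j\<le>n. \<i> ^ j / fact j * (\<Sum>k\<in>K. c k * of_real (\<kappa> k \<bullet> x) ^ j))"
    by (simp add: sum_distrib_left power_mult_distrib mult_ac sum.swap[of _ K])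
  also have "\<dots> = 0" using moments by (simp add: n)
  finally have "plane_waves K \<kappa> c x = (\<Sum>k\<in>K. c k * (exp (?z k) - (\<Sum>j\<le>n. ?z k ^ j / fact j)))"
    by (simp add: plane_waves_def right_diff_distrib sum_subtractf)
  also have "cmod \<dots> \<le> (\<Sum>k\<in>K. cmod (c k) * norm (\<kappa> k) ^ M * norm x ^ M)"
  proof (rule sum_norm_le)
    fix k
    have "cmod (exp (?z k) - (\<Sum>j\<le>n. ?z k ^ j / fact j)) \<le> exp \<bar>Re (?z k)\<bar> * cmod (?z k) ^ Suc n / fact n"
      by (rule Taylor_exp)
    \<comment> \<open>\<open>?z k\<close> is purely imaginary, so the exponential factor of the
      remainder is 1; the factorial is bounded below by 1.\<close>
    also have "\<dots> \<le> \<bar>\<kappa> k \<bullet> x\<bar> ^ M / 1"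
      by (simp add: norm_mult n divide_le_eq mult_left_mono[of 1 "fact n", simplified])
    also have "\<dots> \<le> (norm (\<kappa> k) * norm x) ^ M"
      by (simp add: power_mono Cauchy_Schwarz_ineq2)
    finally show "cmod (c k * (exp (?z k) - (\<Sum>j\<le>n. ?z k ^ j / fact j)))
        \<le> cmod (c k) * norm (\<kappa> k) ^ M * norm x ^ M"
      by (simp add: norm_mult power_mult_distrib mult_left_mono mult.assoc)
  qed
  finally show ?thesis by (simp add: sum_distrib_right)
qed

text \<open>For radii below 1, \<open>N \<le> real M\<close> gives
  \<open>\<delta> ^ M \<le> \<delta> powr N\<close>, so the quotient stays below
  \<open>C\<close>.\<close>

lemma vanishes_to_orderI:
  fixes f :: "real ^ 'd \<Rightarrow> complex"
  assumes bound: "\<And>x. cmod (f x) \<le> C * norm x ^ M" and N: "N \<le> real M"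
  shows "vanishes_to_order N f 0"
proof -
  \<comment> \<open>The bound at a unit vector yields \<open>0 \<le> C\<close>.\<close>
  obtain u :: "real ^ 'd" where u: "norm u = 1" using vector_choose_size[of 1] by auto
  have C: "0 \<le> C" using order_trans[OF norm_ge_zero bound[of u]] by (simp add: u)
  have "\<forall>\<^sub>F \<delta> in at_right (0::real). (SUP y\<in>ball 0 \<delta>. ereal (cmod (f y))) / ereal (\<delta> powr N) \<le> ereal C"
    using eventually_at_right_less[of "0::real"] eventually_at_right_real[OF zero_less_one]
  proof eventually_elim
    case (elim \<delta>)
    have "(SUP y\<in>ball 0 \<delta>. ereal (cmod (f y))) \<le> ereal (C * \<delta> powr N)"
    proof (rule SUP_least)
      fix y :: "real ^ 'd" assume "y \<in> ball 0 \<delta>"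
      have "cmod (f y) \<le> C * norm y ^ M" by (rule bound)
      also have "\<dots> \<le> C * \<delta> ^ M"
        using C \<open>y \<in> ball 0 \<delta>\<close> by (intro mult_left_mono power_mono) auto
      also have "\<delta> ^ M = \<delta> powr real M" using elim by (simp add: powr_realpow)
      also have "C * \<delta> powr real M \<le> C * \<delta> powr N"
        using C elim N by (intro mult_left_mono powr_mono') auto
      finally show "ereal (cmod (f y)) \<le> ereal (C * \<delta> powr N)" by simp
    qed
    then show ?case using elim by (subst ereal_divide_le_pos) (auto simp: mult.commute)
  qed
  then have "Limsup (at_right 0) (\<lambda>\<delta>::real. (SUP y\<in>ball 0 \<delta>. ereal (cmod (f y))) / ereal (\<delta> powr N)) \<le> ereal C"
    by (rule Limsup_bounded)
  then show ?thesis unfolding vanishes_to_order_def by (rule le_less_trans) simp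
qed

section \<open>Independence of exponentials\<close>

text \<open>The sum is a polynomial evaluated at \<open>cis t\<close>. It vanishes on an infinite
  arc, hence identically, and injectivity of \<open>a\<close> keeps the \<open>c k\<close> at
  separate degrees. On (0, pi) the cosine, and so \<open>cis\<close>, is injective.\<close>

lemma exponential_sum_zero_imp_coeffs_zero:
  fixes a :: "'k \<Rightarrow> nat"
  assumes "finite K" "inj_on a K" "k \<in> K"
    and zero: "\<And>t. 0 < t \<Longrightarrow> t < pi \<Longrightarrow> (\<Sum>k\<in>K. c k * exp (\<i> * of_real (real (a k) * t))) = 0"
  shows "c k = 0"
proof -
  define p where "p = (\<Sum>k\<in>K. monom (c k) (a k))"
  have "poly p (cis t) = 0" if "t \<in> {0<..<pi}" for t
    using zero[of t] that by (simp add: p_def poly_sum poly_monom DeMoivre) (simp add: cis_conv_exp mult_ac flip: exp_of_nat_mult)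
  then have "cis ` {0<..<pi} \<subseteq> {z. poly p z = 0}" by auto
  moreover have "inj_on cis {0<..<pi}"
  proof (rule inj_onI)
    fix s t assume "s \<in> {0<..<pi}" "t \<in> {0<..<pi}" "cis s = cis t"
    then show "s = t" using cos_inj_pi[of s t] by (auto dest: arg_cong[of _ _ Re])
  qed
  then have "infinite (cis ` {0<..<pi})"
    using finite_imageD infinite_Ioo pi_gt_zero by blast
  ultimately have "p = 0" using poly_roots_finite finite_subset by blast
  then have "0 = coeff p (a k)" by simp
  also have "\<dots> = (\<Sum>l\<in>K. if l = k then c l else 0)"
    unfolding p_def coeff_sum using assms by (intro sum.cong) (auto dest: inj_onD)
  also have "\<dots> = c k" using assms by simp
  finally show ?thesis by simp
qed

section \<open>Construction of the eigenfunction\<close>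

theorem theorem1:
  fixes N :: real
  assumes "CARD('d::finite) \<ge> 2" and "N > 0"
  shows "\<exists>(lam::real) (f :: real ^ 'd \<Rightarrow> complex).
           lam > 0 \<and>
           torus_L2 f \<and> \<not> (AE x in lebesgue_on torus_cube. f x = 0) \<and>
           torus_laplacian f (\<lambda>x. - (complex_of_real lam * f x)) \<and>
           smooth_fun f \<and>
           vanishes_to_order N f 0"
proof -
  have "\<not> card (UNIV :: 'd set) \<le> Suc 0" using assms(1) by simp
  then obtain p q :: 'd where pq: "p \<noteq> q" by (auto simp: card_le_Suc0_iff_eq)
  define M where "M = nat \<lceil>N\<rceil>"
  have M: "N \<le> real M" "M > 0" using assms(2) by (auto simp: M_def)
  \<comment> \<open>One lattice point more than the M^2 exponent pairs (j, l) with j, l < M.\<close>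
  obtain L :: nat and K :: "(nat \<times> nat) set"
    where K: "L > 0" "finite K" "card K = M * M + 1" "inj_on fst K"
      and L: "\<And>k. k \<in> K \<Longrightarrow> (fst k)\<^sup>2 + (snd k)\<^sup>2 = L"
    using circle_with_many_lattice_points[of "M * M + 1"] by (auto simp: case_prod_beta)
  \<comment> \<open>Equation \<open>i\<close> encodes the exponent pair
    \<open>(i div M, i mod M)\<close>.\<close>
  obtain c :: "nat \<times> nat \<Rightarrow> complex" where c: "\<exists>k\<in>K. c k \<noteq> 0"
    and sys: "\<And>i. i < M * M \<Longrightarrow>
      (\<Sum>k\<in>K. of_nat (fst k) ^ (i div M) * of_nat (snd k) ^ (i mod M) * c k) = 0"
    using underdetermined_homogeneous_system[of K "M * M"
        "\<lambda>i k. of_nat (fst k) ^ (i div M) * of_nat (snd k) ^ (i mod M)"] K by auto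
  have mom: "(\<Sum>k\<in>K. of_nat (fst k) ^ j * of_nat (snd k) ^ l * c k) = 0" if "j < M" "l < M" for j l
  proof -
    have "j * M + l < Suc j * M" using that by simp
    also have "\<dots> \<le> M * M" using that by (intro mult_le_mono1) simp
    finally show ?thesis using sys[of "j * M + l"] that by simp
  qed
  \<comment> \<open>The frequencies lie in one coordinate plane; this is where dimension at least 2
    enters.\<close>
  define \<kappa> :: "nat \<times> nat \<Rightarrow> real ^ 'd" where
    "\<kappa> k = axis p (real (fst k)) + axis q (real (snd k))" for k
  have \<kappa>_inner: "\<kappa> k \<bullet> x = real (fst k) * x $ p + real (snd k) * x $ q" for k x
    by (simp add: \<kappa>_def inner_add_left inner_axis' )
  have \<kappa>_norm: "\<kappa> k \<bullet> \<kappa> k = real L" if "k \<in> K" for k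
    using L[OF that] pq by (simp add: \<kappa>_inner) (simp add: \<kappa>_def axis_def power2_eq_square flip: of_nat_mult of_nat_add)
  define f where "f = plane_waves K \<kappa> c"
  have moments: "(\<Sum>k\<in>K. c k * of_real (\<kappa> k \<bullet> x) ^ j) = 0" if "j < M" for j x
  proof -
    \<comment> \<open>Binomial expansion in the coordinates \<open>p\<close> and \<open>q\<close>;
      the exponents \<open>i\<close> and \<open>j - i\<close> are both below
      \<open>M\<close>.\<close>
    have "(\<Sum>k\<in>K. c k * of_real (\<kappa> k \<bullet> x) ^ j) =
       (\<Sum>i\<le>j. of_nat (j choose i) * of_real (x $ p) ^ i * of_real (x $ q) ^ (j - i) *
          (\<Sum>k\<in>K. of_nat (fst k) ^ i * of_nat (snd k) ^ (j - i) * c k))"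
      by (simp add: \<kappa>_inner binomial_ring power_mult_distrib sum_distrib_left mult_ac sum.swap[of _ K])
    also have "\<dots> = 0" using mom that by (intro sum.neutral) auto
    finally show ?thesis .
  qed
  have per: "torus_periodic (plane_waves K \<kappa> b)" for b
    by (rule torus_periodic_plane_waves) (auto simp: \<kappa>_def axis_def)
  have L2: "torus_L2 (plane_waves K \<kappa> b)" for b
    by (rule torus_L2_continuous[OF continuous_on_plane_waves per norm_plane_waves_le])
  have lap: "classical_laplacian f = (\<lambda>x. - (of_real (real L) * f x))"
    unfolding f_def using \<kappa>_norm by (intro ext classical_laplacian_plane_waves)
  \<comment> \<open>Absorbing the eigenvalue into the coefficients makes \<open>L2\<close>
    applicable to the Laplacian as well.\<close>
  have "classical_laplacian f = plane_waves K \<kappa> (\<lambda>k. - (of_real (real L) * c k))"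
    unfolding lap by (simp add: f_def plane_waves_def fun_eq_iff sum_distrib_left sum_negf mult_ac)
  then have "torus_L2 (classical_laplacian f)" by (simp add: L2)
  then have "torus_laplacian f (classical_laplacian f)"
    unfolding f_def by (intro torus_laplacian_classical L2 smooth_plane_waves)
  then have "torus_laplacian f (\<lambda>x. - (of_real (real L) * f x))" by (simp only: lap)
  moreover have "\<not> (AE x in lebesgue_on torus_cube. f x = 0)"
  proof
    assume ae: "AE x in lebesgue_on torus_cube. f x = 0"
    have "(\<Sum>k\<in>K. c k * exp (\<i> * of_real (real (fst k) * t))) = 0" if "0 < t" "t < pi" for t
    proof -
      \<comment> \<open>On the \<open>p\<close>-axis the second frequency coordinates drop out,
        leaving exponentials with distinct frequencies \<open>fst k\<close>.\<close>
      have "f (axis p t) = 0"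
        using that by (intro AE_torus_cube_eq_0_imp[OF _ ae])
          (auto simp: f_def continuous_on_plane_waves axis_def)
      then show ?thesis using pq by (simp add: f_def plane_waves_def \<kappa>_inner axis_def)
    qed
    then show False using exponential_sum_zero_imp_coeffs_zero[of K fst] K c by blast
  qed
  moreover have "vanishes_to_order N f 0"
    unfolding f_def using norm_plane_waves_le_power[OF moments M(2)] M(1)
    by (rule vanishes_to_orderI)
  moreover have "real L > 0" "torus_L2 f" "smooth_fun f"
    unfolding f_def using K(1) L2 smooth_plane_waves by auto
  ultimately show ?thesis by blast
qed

end
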